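(* A nonzero real Banach lattice $X$ contains lattice-almost isometric copies of $\ell_\infty^2$ if and only if $\lambda^+(X)=1$.
   Context: For a Banach lattice $X$, $S_X^+$ denotes the set of elements $x\in X$ with $x\ge 0$ and $\|x\|=1$. The lattice Schäffer constant is $\lambda^+(X)=\inf\{\max\{\|x-y\|,\|x+y\|\} : x,y\in S_X^+\}$. $\ell_\infty^2$ is $\mathbb R^2$ with the coordinatewise order and the norm $\|(a,b)\|=\max\{|a|,|b|\}$. A Banach lattice isomorphism $T:X\to Y$ is a bijective bounded linear operator with $T(x\vee y)=Tx\vee Ty$ for all $x,y\in X$. $Y$ contains lattice-almost isometric copies of $X$ if for each $\varepsilon>0$ there exist a sublattice $Z_\varepsilon$ of $Y$ and a Banach lattice isomorphism $T_\varepsilon:X\to Z_\varepsilon$ with $\|T_\varepsilon\|\,\|T_\varepsilon^{-1}\|\le 1+\varepsilon$. *)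

theory Defs
  imports "HOL-Analysis.Analysis" "HOL-Library.Lattice_Algebras"
begin

text \<open>
  Real Banach lattices.  The superclass
  \<^class>\<open>lattice_ab_group_add_abs\<close> fixes the modulus to be
  \<^prop>\<open>\<bar>a\<bar> = sup a (- a)\<close>.
\<close>

class banach_lattice = banach + ordered_real_vector + lattice_ab_group_add_abs +
  assumes norm_mono_abs: "\<bar>x\<bar> \<le> \<bar>y\<bar> \<Longrightarrow> norm x \<le> norm y"

definition unit_sphere_pos :: "'a::banach_lattice set" where
  "unit_sphere_pos = {x. 0 \<le> x \<and> norm x = 1}"

definition lattice_schaeffer :: "'a::banach_lattice itself \<Rightarrow> real" where
  "lattice_schaeffer _ =
     Inf {max (norm (x - y)) (norm (x + y)) | x y :: 'a. x \<in> unit_sphere_pos \<and> y \<in> unit_sphere_pos}"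

definition sublattice :: "'a::banach_lattice set \<Rightarrow> bool" where
  "sublattice Z \<longleftrightarrow> subspace Z \<and> (\<forall>x\<in>Z. \<forall>y\<in>Z. sup x y \<in> Z \<and> inf x y \<in> Z)"

text \<open>
  The target of a Banach lattice isomorphism is itself a Banach lattice, so the sublattice
  \<open>Z\<close> has to be complete, i.e. closed.
\<close>

definition banach_lattice_iso_onto ::
    "('a::banach_lattice \<Rightarrow> 'b::banach_lattice) \<Rightarrow> 'b set \<Rightarrow> bool" where
  "banach_lattice_iso_onto T Z \<longleftrightarrow>
     sublattice Z \<and> closed Z \<and> bounded_linear T \<and> bij_betw T UNIV Z \<and>
     (\<forall>x y. T (sup x y) = sup (T x) (T y))"

text \<open>
  Operator norm of a map defined on a subspace \<open>Z\<close>; it is the restriction to \<open>Z\<close> of the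
  supremum defining \<^const>\<open>onorm\<close>.
\<close>

definition onorm_on :: "'a::real_normed_vector set \<Rightarrow> ('a \<Rightarrow> 'b::real_normed_vector) \<Rightarrow> real" where
  "onorm_on Z f = (SUP z\<in>Z. norm (f z) / norm z)"

text \<open>
  For an isomorphism \<open>T\<close> onto \<open>Z\<close>, the inverse \<open>inv T\<close> is bounded on \<open>Z\<close> by the open mapping
  theorem, so the supremum in \<open>onorm_on Z (inv T)\<close> is that of a bounded set.
\<close>

definition contains_lattice_almost_isometric_copies ::
    "'y::banach_lattice itself \<Rightarrow> 'x::banach_lattice itself \<Rightarrow> bool" where
  "contains_lattice_almost_isometric_copies _ _ \<longleftrightarrow>
     (\<forall>\<epsilon>>0. \<exists>Z :: 'y set. \<exists>T :: 'x \<Rightarrow> 'y.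
        banach_lattice_iso_onto T Z \<and> onorm T * onorm_on Z (inv T) \<le> 1 + \<epsilon>)"

text \<open>
  The space \<open>\<ell>\<^sub>\<infinity>\<^sup>2\<close>.  A separate type is needed because the library's products and finite
  Cartesian powers carry the Euclidean norm.
\<close>

datatype linf2 = Linf2 (crd1: real) (crd2: real)

lemma linf2_eq_iff: "x = y \<longleftrightarrow> crd1 x = crd1 y \<and> crd2 x = crd2 y"
  by (cases x; cases y) simp

instantiation linf2 :: real_vector
begin

definition "0 = Linf2 0 0"
definition "x + y = Linf2 (crd1 x + crd1 y) (crd2 x + crd2 y)"
definition "x - y = Linf2 (crd1 x - crd1 y) (crd2 x - crd2 y)"
definition "- x = Linf2 (- crd1 x) (- crd2 x)"
definition "scaleR c x = Linf2 (c * crd1 x) (c * crd2 x)"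

instance
  by standard
    (simp_all add: zero_linf2_def plus_linf2_def minus_linf2_def uminus_linf2_def scaleR_linf2_def
      linf2_eq_iff algebra_simps)

end

instantiation linf2 :: real_normed_vector
begin

definition "norm x = max \<bar>crd1 x\<bar> \<bar>crd2 x\<bar>"
definition "sgn x = x /\<^sub>R norm x" for x :: linf2
definition "dist x y = norm (x - y)" for x y :: linf2
definition [code del]:
  "(uniformity :: (linf2 \<times> linf2) filter) = (INF e\<in>{0 <..}. principal {(x, y). dist x y < e})"
definition [code del]:
  "open (U :: linf2 set) \<longleftrightarrow> (\<forall>x\<in>U. eventually (\<lambda>(x', y). x' = x \<longrightarrow> y \<in> U) uniformity)"

instance
proof
  fix x y :: linf2 and a :: real and U :: "linf2 set"
  show "dist x y = norm (x - y)" by (rule dist_linf2_def)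
  show "sgn x = x /\<^sub>R norm x" by (rule sgn_linf2_def)
  show "(uniformity :: (linf2 \<times> linf2) filter) = (INF e\<in>{0 <..}. principal {(x, y). dist x y < e})"
    by (rule uniformity_linf2_def)
  show "open U \<longleftrightarrow> (\<forall>x\<in>U. eventually (\<lambda>(x', y). x' = x \<longrightarrow> y \<in> U) uniformity)"
    by (rule open_linf2_def)
  show "norm x = 0 \<longleftrightarrow> x = 0"
    by (auto simp: norm_linf2_def zero_linf2_def linf2_eq_iff max_def)
  show "norm (x + y) \<le> norm x + norm y"
    by (auto simp: norm_linf2_def plus_linf2_def max_def)
  show "norm (a *\<^sub>R x) = \<bar>a\<bar> * norm x"
    by (simp add: norm_linf2_def scaleR_linf2_def abs_mult max_mult_distrib_left)
qed

end

instance linf2 :: banach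
proof
  fix X :: "nat \<Rightarrow> linf2"
  assume X: "Cauchy X"
  have *: "dist (crd1 u) (crd1 v) \<le> dist u v" "dist (crd2 u) (crd2 v) \<le> dist u v" for u v
    by (simp_all add: dist_linf2_def dist_real_def norm_linf2_def minus_linf2_def)
  have "Cauchy (\<lambda>n. crd1 (X n))" "Cauchy (\<lambda>n. crd2 (X n))"
    using X unfolding Cauchy_def by (meson * le_less_trans)+
  then obtain a b where ab: "(\<lambda>n. crd1 (X n)) \<longlonglongrightarrow> a" "(\<lambda>n. crd2 (X n)) \<longlonglongrightarrow> b"
    by (meson Cauchy_convergent convergentD)
  have "X \<longlonglongrightarrow> Linf2 a b"
    unfolding lim_sequentially
  proof (intro allI impI)
    fix e :: real assume "0 < e"
    with ab obtain M N where "\<forall>n\<ge>M. dist (crd1 (X n)) a < e" "\<forall>n\<ge>N. dist (crd2 (X n)) b < e"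
      unfolding lim_sequentially by meson
    then have "\<forall>n\<ge>max M N. dist (X n) (Linf2 a b) < e"
      by (simp add: dist_linf2_def dist_real_def norm_linf2_def minus_linf2_def)
    then show "\<exists>K. \<forall>n\<ge>K. dist (X n) (Linf2 a b) < e" ..
  qed
  then show "convergent X" by (rule convergentI)
qed

instantiation linf2 :: banach_lattice
begin

definition "x \<le> y \<longleftrightarrow> crd1 x \<le> crd1 y \<and> crd2 x \<le> crd2 y"
definition "x < y \<longleftrightarrow> x \<le> y \<and> \<not> y \<le> x" for x y :: linf2
definition "sup x y = Linf2 (sup (crd1 x) (crd1 y)) (sup (crd2 x) (crd2 y))"
definition "inf x y = Linf2 (inf (crd1 x) (crd1 y)) (inf (crd2 x) (crd2 y))"
definition "abs x = Linf2 \<bar>crd1 x\<bar> \<bar>crd2 x\<bar>"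

instance
proof
  fix x y z :: linf2 and a b :: real
  show "x < y \<longleftrightarrow> x \<le> y \<and> \<not> y \<le> x" by (rule less_linf2_def)
  show "x \<le> x" by (simp add: less_eq_linf2_def)
  show "x \<le> y \<Longrightarrow> y \<le> z \<Longrightarrow> x \<le> z" "x \<le> y \<Longrightarrow> y \<le> x \<Longrightarrow> x = y" "x \<le> y \<Longrightarrow> z + x \<le> z + y"
    by (auto simp: less_eq_linf2_def plus_linf2_def linf2_eq_iff)
  show "x \<le> y \<Longrightarrow> 0 \<le> a \<Longrightarrow> a *\<^sub>R x \<le> a *\<^sub>R y" "a \<le> b \<Longrightarrow> 0 \<le> x \<Longrightarrow> a *\<^sub>R x \<le> b *\<^sub>R x"
    by (auto simp: less_eq_linf2_def scaleR_linf2_def zero_linf2_def mult_left_mono mult_right_mono)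
  show "inf x y \<le> x" "inf x y \<le> y" "x \<le> y \<Longrightarrow> x \<le> z \<Longrightarrow> x \<le> inf y z"
    "x \<le> sup x y" "y \<le> sup x y" "y \<le> x \<Longrightarrow> z \<le> x \<Longrightarrow> sup y z \<le> x"
    by (auto simp: less_eq_linf2_def inf_linf2_def sup_linf2_def)
  show "\<bar>x\<bar> = sup x (- x)"
    by (simp add: abs_linf2_def sup_linf2_def uminus_linf2_def linf2_eq_iff sup_real_def max_def abs_if)
  show "\<bar>x\<bar> \<le> \<bar>y\<bar> \<Longrightarrow> norm x \<le> norm y"
    by (auto simp: less_eq_linf2_def abs_linf2_def norm_linf2_def)
qed

end

end

theory Submission
  imports Defs
begin

text \<open>
  For positive \<open>x\<close>, \<open>y\<close> one has \<open>\<bar>x - y\<bar> \<le> x + y\<close>, so the Schaeffer constant is just the infimum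
  of \<open>\<parallel>x + y\<parallel>\<close> over positive unit vectors, and it is at least \<open>1\<close>.  It equals \<open>1\<close> exactly when
  there are positive unit vectors with \<open>\<parallel>x + y\<parallel>\<close> arbitrarily close to \<open>1\<close>
  (\<open>lattice_schaeffer_eq_1_iff\<close>).

  Given a lattice isomorphism \<open>T\<close> from \<open>\<ell>\<^sub>\<infinity>\<^sup>2\<close> with small distortion, the normalised images of the
  two unit vectors are such a pair: their sum is \<open>T z\<close> for some \<open>z\<close> whose coordinates are at most
  \<open>\<parallel>T\<^sup>-\<^sup>1\<parallel>\<close>.

  Conversely, a pair \<open>x\<close>, \<open>y\<close> with \<open>\<parallel>x + y\<parallel> \<le> 1 + \<delta>\<close> becomes disjoint once the common part \<open>x \<sqinter> y\<close>
  is removed, and little norm is lost: \<open>u = x - x \<sqinter> y\<close> satisfies \<open>2 x \<le> (x + y) + u\<close>, whence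
  \<open>\<parallel>u\<parallel> \<ge> 1 - \<delta>\<close>, and likewise for \<open>v = y - x \<sqinter> y\<close>.  Disjointness makes
  \<open>(a, b) \<mapsto> a u + b v\<close> a lattice homomorphism, and its distortion is at most
  \<open>\<parallel>u + v\<parallel> / min \<parallel>u\<parallel> \<parallel>v\<parallel> \<le> (1 + \<delta>) / (1 - \<delta>)\<close> (\<open>copy_from_disjoint_pair\<close>).
\<close>

section \<open>The norm of a Banach lattice\<close>

lemma norm_mono:
  fixes x y :: "'a::banach_lattice"
  assumes "0 \<le> x" "x \<le> y"
  shows "norm x \<le> norm y"
  using assms by (intro norm_mono_abs) (simp add: abs_of_nonneg)

lemma norm_abs_eq:
  fixes x :: "'a::banach_lattice"
  shows "norm \<bar>x\<bar> = norm x"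
  by (intro antisym norm_mono_abs) simp_all

lemma norm_diff_le_norm_add:
  fixes x y :: "'a::banach_lattice"
  assumes "0 \<le> x" "0 \<le> y"
  shows "norm (x - y) \<le> norm (x + y)"
proof (rule norm_mono_abs)
  have "\<bar>x - y\<bar> \<le> \<bar>x\<bar> + \<bar>y\<bar>" by (rule abs_triangle_ineq4)
  then show "\<bar>x - y\<bar> \<le> \<bar>x + y\<bar>" using assms by (simp add: abs_of_nonneg)
qed

lemma unit_sphere_pos_nonempty:
  assumes "\<exists>x :: 'a::banach_lattice. x \<noteq> 0"
  shows "(unit_sphere_pos :: 'a set) \<noteq> {}"
proof -
  obtain x :: 'a where "x \<noteq> 0" using assms by blast
  then have "\<bar>x\<bar> /\<^sub>R norm x \<in> unit_sphere_pos"
    by (simp add: unit_sphere_pos_def norm_abs_eq scaleR_nonneg_nonneg)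
  then show ?thesis by blast
qed

section \<open>The Schaeffer constant\<close>

lemma lattice_schaeffer_eq_Inf_norm_add:
  "lattice_schaeffer TYPE('a::banach_lattice) =
     Inf {norm (x + y) | x y :: 'a. x \<in> unit_sphere_pos \<and> y \<in> unit_sphere_pos}"
proof -
  have "max (norm (x - y)) (norm (x + y)) = norm (x + y)"
    if "x \<in> unit_sphere_pos" "y \<in> unit_sphere_pos" for x y :: 'a
    using that norm_diff_le_norm_add[of x y] by (simp add: unit_sphere_pos_def)
  then show ?thesis
    unfolding lattice_schaeffer_def by (intro arg_cong[where f = Inf]) (auto, metis)
qed

lemma lattice_schaeffer_eq_1_iff:
  assumes "\<exists>x :: 'a::banach_lattice. x \<noteq> 0"
  shows "lattice_schaeffer TYPE('a) = 1 \<longleftrightarrow>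
    (\<forall>\<delta>>0. \<exists>x\<in>unit_sphere_pos. \<exists>y\<in>unit_sphere_pos. norm (x + y :: 'a) \<le> 1 + \<delta>)"
proof -
  define A where "A = {norm (x + y) | x y :: 'a. x \<in> unit_sphere_pos \<and> y \<in> unit_sphere_pos}"
  have "A \<noteq> {}"
    unfolding A_def using unit_sphere_pos_nonempty[OF assms] by blast
  have ge: "1 \<le> r" if "r \<in> A" for r
  proof -
    from that obtain x y :: 'a where "r = norm (x + y)" "x \<in> unit_sphere_pos" "y \<in> unit_sphere_pos"
      by (auto simp: A_def)
    then show ?thesis using norm_mono[of x "x + y"] by (simp add: unit_sphere_pos_def)
  qed
  then have bdd: "bdd_below A" by (rule bdd_belowI)
  have "Inf A = 1 \<longleftrightarrow> (\<forall>\<delta>>0. \<exists>r\<in>A. r \<le> 1 + \<delta>)"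
  proof
    assume "Inf A = 1"
    then show "\<forall>\<delta>>0. \<exists>r\<in>A. r \<le> 1 + \<delta>"
      using cInf_less_iff[OF \<open>A \<noteq> {}\<close> bdd] by (metis less_add_same_cancel1 less_imp_le)
  next
    assume r: "\<forall>\<delta>>0. \<exists>r\<in>A. r \<le> 1 + \<delta>"
    have "Inf A \<le> 1"
    proof (rule field_le_epsilon)
      fix e :: real assume "0 < e"
      with r obtain r where "r \<in> A" "r \<le> 1 + e" by blast
      then show "Inf A \<le> 1 + e" using cInf_lower[OF _ bdd] by fastforce
    qed
    then show "Inf A = 1" using cInf_greatest[OF \<open>A \<noteq> {}\<close> ge] by simp
  qed
  moreover have "(\<exists>r\<in>A. r \<le> c) \<longleftrightarrow>
      (\<exists>x\<in>unit_sphere_pos. \<exists>y\<in>unit_sphere_pos. norm (x + y :: 'a) \<le> c)" for c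
    unfolding A_def by blast
  ultimately show ?thesis
    unfolding lattice_schaeffer_eq_Inf_norm_add A_def by simp
qed

section \<open>Lattice homomorphisms from the two-dimensional space\<close>

lemma lattice_hom_abs:
  fixes T :: "'a::banach_lattice \<Rightarrow> 'b::banach_lattice"
  assumes "linear T" "\<And>x y. T (sup x y) = sup (T x) (T y)"
  shows "T \<bar>x\<bar> = \<bar>T x\<bar>"
  using assms by (simp add: abs_lattice linear_neg)

lemma lattice_hom_nonneg:
  fixes T :: "'a::banach_lattice \<Rightarrow> 'b::banach_lattice"
  assumes "linear T" "\<And>x y. T (sup x y) = sup (T x) (T y)" "0 \<le> x"
  shows "0 \<le> T x"
  by (metis assms abs_ge_zero abs_of_nonneg lattice_hom_abs)

lemma linear_linf2_eq:
  assumes "linear T"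
  shows "T z = crd1 z *\<^sub>R T (Linf2 1 0) + crd2 z *\<^sub>R T (Linf2 0 1)"
proof -
  have "z = crd1 z *\<^sub>R Linf2 1 0 + crd2 z *\<^sub>R Linf2 0 1"
    by (simp add: linf2_eq_iff plus_linf2_def scaleR_linf2_def)
  then show ?thesis using assms by (metis linear_add linear_scale)
qed

text \<open>
  A lattice homomorphism does not see signs: \<open>\<parallel>T (a, b)\<parallel> = \<parallel>T (\<bar>a\<bar>, \<bar>b\<bar>)\<parallel>\<close>.  Dropping one of the two
  positive summands bounds this from below, enlarging both coefficients to \<open>\<parallel>(a, b)\<parallel>\<close> bounds it
  from above.
\<close>

lemma lattice_hom_linf2_bounds:
  fixes T :: "linf2 \<Rightarrow> 'b::banach_lattice"
  assumes lin: "linear T" and sup: "\<And>x y. T (sup x y) = sup (T x) (T y)"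
  shows "\<bar>crd1 z\<bar> * norm (T (Linf2 1 0)) \<le> norm (T z)"
    and "\<bar>crd2 z\<bar> * norm (T (Linf2 0 1)) \<le> norm (T z)"
    and "norm (T z) \<le> norm z * norm (T (Linf2 1 0) + T (Linf2 0 1))"
proof -
  define u v where "u = T (Linf2 1 0)" and "v = T (Linf2 0 1)"
  have pos: "0 \<le> u" "0 \<le> v"
    unfolding u_def v_def
    by (auto intro!: lattice_hom_nonneg[of T, OF lin sup] simp: less_eq_linf2_def zero_linf2_def)
  have "norm (T z) = norm (T \<bar>z\<bar>)"
    by (simp add: lattice_hom_abs[of T, OF lin sup] norm_abs_eq)
  also have "T \<bar>z\<bar> = \<bar>crd1 z\<bar> *\<^sub>R u + \<bar>crd2 z\<bar> *\<^sub>R v"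
    by (subst linear_linf2_eq[OF lin]) (simp add: u_def v_def abs_linf2_def)
  finally have eq: "norm (T z) = norm (\<bar>crd1 z\<bar> *\<^sub>R u + \<bar>crd2 z\<bar> *\<^sub>R v)" .
  have nn: "0 \<le> \<bar>crd1 z\<bar> *\<^sub>R u" "0 \<le> \<bar>crd2 z\<bar> *\<^sub>R v"
    using pos by (simp_all add: scaleR_nonneg_nonneg)
  show "\<bar>crd1 z\<bar> * norm (T (Linf2 1 0)) \<le> norm (T z)"
    using norm_mono[OF nn(1), of "\<bar>crd1 z\<bar> *\<^sub>R u + \<bar>crd2 z\<bar> *\<^sub>R v"] nn eq by (simp add: u_def)
  show "\<bar>crd2 z\<bar> * norm (T (Linf2 0 1)) \<le> norm (T z)"
    using norm_mono[OF nn(2), of "\<bar>crd1 z\<bar> *\<^sub>R u + \<bar>crd2 z\<bar> *\<^sub>R v"] nn eq by (simp add: v_def)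
  have "\<bar>crd1 z\<bar> *\<^sub>R u + \<bar>crd2 z\<bar> *\<^sub>R v \<le> norm z *\<^sub>R (u + v)"
    unfolding scaleR_add_right using pos
    by (intro add_mono scaleR_right_mono) (simp_all add: norm_linf2_def)
  then have "norm (T z) \<le> norm (norm z *\<^sub>R (u + v))"
    unfolding eq using nn by (intro norm_mono) (simp_all add: add_nonneg_nonneg)
  then show "norm (T z) \<le> norm z * norm (T (Linf2 1 0) + T (Linf2 0 1))"
    by (simp add: u_def v_def)
qed

lemma lattice_hom_linf2_bounded_below:
  fixes T :: "linf2 \<Rightarrow> 'b::banach_lattice"
  assumes "linear T" "\<And>x y. T (sup x y) = sup (T x) (T y)"
    and "m \<le> norm (T (Linf2 1 0))" "m \<le> norm (T (Linf2 0 1))"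
  shows "m * norm z \<le> norm (T z)"
proof -
  have "\<bar>crd1 z\<bar> * m \<le> norm (T z)" "\<bar>crd2 z\<bar> * m \<le> norm (T z)"
    using lattice_hom_linf2_bounds(1,2)[of T, OF assms(1,2)] mult_left_mono[OF assms(3) abs_ge_zero]
      mult_left_mono[OF assms(4) abs_ge_zero] by (meson order_trans)+
  then show ?thesis by (auto simp: norm_linf2_def max_def mult.commute)
qed

text \<open>
  A supremum of quotients over \<open>Z\<close> is only meaningful when these are bounded, which is what a lower
  estimate for \<open>T\<close> provides.
\<close>

lemma norm_inv_quotient_le:
  fixes T :: "'a::real_normed_vector \<Rightarrow> 'b::real_normed_vector"
  assumes "inj T" "0 < m" "\<And>z. m * norm z \<le> norm (T z)" "y \<in> range T"
  shows "norm (inv T y) / norm y \<le> 1 / m"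
proof -
  obtain z where "y = T z" using assms(4) by blast
  then show ?thesis
    using assms(1,2) assms(3)[of z] by (cases "norm (T z) = 0") (simp_all add: field_simps)
qed

section \<open>From a copy to almost extremal vectors\<close>

lemma copy_imp_small_norm_add:
  fixes T :: "linf2 \<Rightarrow> 'b::banach_lattice"
  assumes iso: "banach_lattice_iso_onto T Z"
  shows "\<exists>x\<in>unit_sphere_pos. \<exists>y\<in>unit_sphere_pos. norm (x + y :: 'b) \<le> onorm T * onorm_on Z (inv T)"
proof -
  have bl: "bounded_linear T" and inj: "inj T" and Z: "Z = range T"
    and sup: "\<And>x y. T (sup x y) = sup (T x) (T y)"
    using iso by (auto simp: banach_lattice_iso_onto_def bij_betw_def)
  then have lin: "linear T" by (simp add: bounded_linear.linear)
  define u v where "u = T (Linf2 1 0)" and "v = T (Linf2 0 1)"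
  have pos: "0 \<le> u" "0 \<le> v"
    unfolding u_def v_def
    by (auto intro!: lattice_hom_nonneg[of T, OF lin sup] simp: less_eq_linf2_def zero_linf2_def)
  have "u \<noteq> 0" "v \<noteq> 0"
    using inj lin unfolding u_def v_def
    by (auto simp: linear_injective_0 zero_linf2_def)
  define m where "m = min (norm u) (norm v)"
  have "0 < m" using \<open>u \<noteq> 0\<close> \<open>v \<noteq> 0\<close> by (simp add: m_def)
  have below: "m * norm z \<le> norm (T z)" for z
    by (rule lattice_hom_linf2_bounded_below[of T, OF lin sup]) (simp_all add: m_def u_def v_def)
  have bdd: "bdd_above ((\<lambda>z. norm (inv T z) / norm z) ` Z)"
    unfolding Z using norm_inv_quotient_le[OF inj \<open>0 < m\<close> below] by (rule bdd_aboveI2)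
  have le: "norm w / norm (T w) \<le> onorm_on Z (inv T)" for w
    unfolding onorm_on_def
    using cSUP_upper[OF _ bdd, of "T w"] inj by (simp add: Z)
  let ?z = "Linf2 (1 / norm u) (1 / norm v)"
  have "T ?z = u /\<^sub>R norm u + v /\<^sub>R norm v"
    by (subst linear_linf2_eq[OF lin]) (simp add: u_def v_def divide_inverse)
  then have "norm (u /\<^sub>R norm u + v /\<^sub>R norm v) \<le> onorm T * norm ?z"
    using onorm[OF bl, of ?z] by simp
  also have "norm ?z \<le> onorm_on Z (inv T)"
    using le[of "Linf2 1 0"] le[of "Linf2 0 1"] by (simp add: norm_linf2_def u_def v_def)
  finally have "norm (u /\<^sub>R norm u + v /\<^sub>R norm v) \<le> onorm T * onorm_on Z (inv T)"
    using onorm_pos_le[OF bl] by (simp add: mult_left_mono)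
  moreover have "u /\<^sub>R norm u \<in> unit_sphere_pos" "v /\<^sub>R norm v \<in> unit_sphere_pos"
    using pos \<open>u \<noteq> 0\<close> \<open>v \<noteq> 0\<close> by (simp_all add: unit_sphere_pos_def scaleR_nonneg_nonneg)
  ultimately show ?thesis by blast
qed

section \<open>From a disjoint pair to a copy\<close>

text \<open>
  Once \<open>a\<close> and \<open>b\<close> are enlarged to a common positive factor, dividing by it turns a lower bound of
  the multiples into a lower bound of \<open>u\<close> and \<open>v\<close>.
\<close>

lemma inf_scaleR_eq_0:
  fixes u v :: "'a::banach_lattice"
  assumes uv: "0 \<le> u" "0 \<le> v" "inf u v = 0" and ab: "0 \<le> a" "0 \<le> b"
  shows "inf (a *\<^sub>R u) (b *\<^sub>R v) = 0"
proof (rule antisym)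
  \<comment> \<open>Adding \<open>1\<close> makes the common factor invertible even when both coefficients vanish.\<close>
  define c where "c = max a b + 1"
  have "0 < c" using ab by (simp add: c_def)
  let ?w = "inf (a *\<^sub>R u) (b *\<^sub>R v)"
  have "?w \<le> c *\<^sub>R u" "?w \<le> c *\<^sub>R v"
    using uv ab by (simp_all add: c_def le_infI1 le_infI2 scaleR_right_mono)
  then have "?w /\<^sub>R c \<le> inf u v"
    using \<open>0 < c\<close> by (simp add: pos_divideR_le_eq)
  then show "?w \<le> 0"
    using uv \<open>0 < c\<close> by (simp add: pos_divideR_le_eq)
  show "0 \<le> ?w" using uv ab by (simp add: scaleR_nonneg_nonneg)
qed

text \<open>
  If the coefficients are ordered the same way, one argument dominates the other.  Otherwise the two
  arguments differ from a common lower vector by disjoint positive vectors, and the supremum of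
  disjoint vectors is their sum.
\<close>

lemma sup_disjoint_combination:
  fixes u v :: "'a::banach_lattice"
  assumes uv: "0 \<le> u" "0 \<le> v" "inf u v = 0"
  shows "sup (a *\<^sub>R u + b *\<^sub>R v) (c *\<^sub>R u + d *\<^sub>R v) = max a c *\<^sub>R u + max b d *\<^sub>R v"
proof -
  have mixed: "sup (a *\<^sub>R u + b *\<^sub>R v) (c *\<^sub>R u + d *\<^sub>R v) = a *\<^sub>R u + d *\<^sub>R v"
    if "c \<le> a" "b \<le> d" for a b c d
  proof -
    define s p q where "s = c *\<^sub>R u + b *\<^sub>R v" and "p = (a - c) *\<^sub>R u" and "q = (d - b) *\<^sub>R v"
    have "inf p q = 0"
      unfolding p_def q_def using that by (intro inf_scaleR_eq_0 uv) simp_all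
    then have "sup p q = p + q" using add_eq_inf_sup[of p q] by simp
    then have "sup (s + p) (s + q) = s + (p + q)" by (simp only: add_sup_distrib_left[symmetric])
    then show ?thesis by (simp add: s_def p_def q_def algebra_simps)
  qed
  have mono: "a *\<^sub>R u + b *\<^sub>R v \<le> c *\<^sub>R u + d *\<^sub>R v" if "a \<le> c" "b \<le> d" for a b c d
    using that uv by (intro add_mono scaleR_right_mono)
  consider "c \<le> a" "b \<le> d" | "a \<le> c" "d \<le> b" | "a \<le> c" "b \<le> d" | "c \<le> a" "d \<le> b"
    by linarith
  then show ?thesis
  proof cases
    case 1
    then show ?thesis using mixed[of c a b d] by simp
  next
    case 2
    then show ?thesis using mixed[of a c d b] by (simp add: sup_commute)
  next
    case 3
    then show ?thesis using mono[of a c b d] by (simp add: sup_absorb2)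
  next
    case 4
    then show ?thesis using mono[of c a d b] by (simp add: sup_absorb1)
  qed
qed

text \<open>
  The map is \<open>(a, b) \<mapsto> a u + b v\<close>.  Its lower bound by \<open>m\<close> does three things: it makes the map
  injective, makes the range complete and hence closed, and bounds the inverse by \<open>1 / m\<close>.
\<close>

lemma copy_from_disjoint_pair:
  fixes u v :: "'a::banach_lattice"
  assumes uv: "0 \<le> u" "0 \<le> v" "inf u v = 0"
    and m: "0 < m" "m \<le> norm u" "m \<le> norm v"
  shows "\<exists>Z T. banach_lattice_iso_onto (T :: linf2 \<Rightarrow> 'a) Z \<and>
           onorm T * onorm_on Z (inv T) \<le> norm (u + v) / m"
proof (intro exI conjI)
  define T where "T = (\<lambda>z. crd1 z *\<^sub>R u + crd2 z *\<^sub>R v)"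
  have T_unit: "T (Linf2 1 0) = u" "T (Linf2 0 1) = v" by (simp_all add: T_def)
  have lin: "linear T"
    by (rule linearI) (simp_all add: T_def plus_linf2_def scaleR_linf2_def algebra_simps)
  have sup: "T (sup x y) = sup (T x) (T y)" for x y
    by (simp add: T_def sup_disjoint_combination[OF uv] sup_linf2_def sup_real_def)
  have inf: "T (inf x y) = inf (T x) (T y)" for x y
    unfolding inf_eq_neg_sup linear_neg[OF lin] sup ..
  have below: "m * norm z \<le> norm (T z)" for z
    using m by (intro lattice_hom_linf2_bounded_below[of T, OF lin sup]) (simp_all add: T_unit)
  have above: "norm (T z) \<le> norm (u + v) * norm z" for z
    using lattice_hom_linf2_bounds(3)[of T, OF lin sup, of z] by (simp add: T_unit mult.commute)
  have bl: "bounded_linear T"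
    using lin above by (auto intro!: bounded_linear_intro[of _ "norm (u + v)"]
      simp: linear_add linear_scale mult.commute)
  have inj: "inj T"
    unfolding linear_injective_0[OF lin]
  proof (intro allI impI)
    fix z assume "T z = 0"
    then have "m * norm z \<le> 0" using below[of z] by simp
    then show "z = 0" using m(1) by (simp add: mult_le_0_iff)
  qed
  have "complete (range T)"
    by (rule complete_isometric_image[OF m(1) _ bl]) (simp_all add: below complete_UNIV)
  then have "closed (range T)" by (rule complete_imp_closed)
  moreover have "subspace (range T)"
    by (intro linear_subspace_image[OF lin]) simp
  ultimately show "banach_lattice_iso_onto T (range T)"
    unfolding banach_lattice_iso_onto_def sublattice_def
    using bl inj sup by (auto simp: bij_betw_def simp flip: sup inf)
  have "onorm T \<le> norm (u + v)"
    using above by (intro onorm_bound) simp_all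
  moreover have "onorm_on (range T) (inv T) \<le> 1 / m"
    unfolding onorm_on_def by (intro cSUP_least norm_inv_quotient_le[OF inj m(1) below]) auto
  ultimately have "onorm T * onorm_on (range T) (inv T) \<le> onorm T * (1 / m)"
    "onorm T * (1 / m) \<le> norm (u + v) * (1 / m)"
    using m(1) onorm_pos_le[OF bl] by (simp_all only: mult_left_mono mult_right_mono
      zero_le_divide_1_iff less_imp_le)
  then show "onorm T * onorm_on (range T) (inv T) \<le> norm (u + v) / m" by simp
qed

text \<open>
  Removing the common part costs little norm because \<open>x \<sqinter> y \<le> y\<close> gives
  \<open>2 x \<le> (x + y) + (x - x \<sqinter> y)\<close>.
\<close>

lemma norm_diff_inf_ge:
  fixes x y :: "'a::banach_lattice"
  assumes "0 \<le> x"
  shows "2 * norm x - norm (x + y) \<le> norm (x - inf x y)"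
proof -
  have "x + inf x y \<le> x + y" by simp
  then have "2 *\<^sub>R x \<le> (x + y) + (x - inf x y)"
    by (simp add: scaleR_2 algebra_simps del: diff_inf_eq_sup)
  then have "norm (2 *\<^sub>R x) \<le> norm ((x + y) + (x - inf x y))"
    using assms by (intro norm_mono scaleR_nonneg_nonneg) simp_all
  also have "\<dots> \<le> norm (x + y) + norm (x - inf x y)" by (rule norm_triangle_ineq)
  finally show ?thesis by simp
qed

lemma small_norm_add_imp_copy:
  fixes x y :: "'a::banach_lattice"
  assumes xy: "x \<in> unit_sphere_pos" "y \<in> unit_sphere_pos"
    and \<delta>: "norm (x + y) \<le> 1 + \<delta>" "\<delta> < 1"
  shows "\<exists>Z T. banach_lattice_iso_onto (T :: linf2 \<Rightarrow> 'a) Z \<and>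
           onorm T * onorm_on Z (inv T) \<le> (1 + \<delta>) / (1 - \<delta>)"
proof -
  define w where "w = inf x y"
  define u v where "u = x - w" and "v = y - w"
  have pos: "0 \<le> x" "0 \<le> y" "norm x = 1" "norm y = 1"
    using xy by (simp_all add: unit_sphere_pos_def)
  then have "0 \<le> w" "0 \<le> u" "0 \<le> v" by (simp_all add: w_def u_def v_def del: diff_inf_eq_sup)
  have "inf u v + w = w"
    by (simp add: add_inf_distrib_right u_def v_def) (simp add: w_def)
  then have "inf u v = 0" by simp
  have "1 - \<delta> \<le> norm u" "1 - \<delta> \<le> norm v"
    using norm_diff_inf_ge[OF pos(1), of y] norm_diff_inf_ge[OF pos(2), of x] pos \<delta>
    by (simp_all add: u_def v_def w_def inf_commute add.commute)
  then obtain Z and T :: "linf2 \<Rightarrow> 'a" where "banach_lattice_iso_onto T Z"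
    "onorm T * onorm_on Z (inv T) \<le> norm (u + v) / (1 - \<delta>)"
    using copy_from_disjoint_pair[of u v "1 - \<delta>"] \<open>0 \<le> u\<close> \<open>0 \<le> v\<close> \<open>inf u v = 0\<close> \<delta>(2) by auto
  moreover have "norm (u + v) \<le> 1 + \<delta>"
  proof -
    have "u + v \<le> x + y" using \<open>0 \<le> w\<close> by (intro add_mono) (simp_all add: u_def v_def)
    then show ?thesis
      using norm_mono[of "u + v" "x + y"] \<open>0 \<le> u\<close> \<open>0 \<le> v\<close> \<delta>(1) by simp
  qed
  then have "norm (u + v) / (1 - \<delta>) \<le> (1 + \<delta>) / (1 - \<delta>)"
    using \<delta>(2) by (intro divide_right_mono) simp_all
  ultimately show ?thesis by (meson order_trans)
qed

section \<open>The characterisation\<close>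

theorem theorem5p4:
  assumes nonzero: "\<exists>x :: 'a::banach_lattice. x \<noteq> 0"
  shows "contains_lattice_almost_isometric_copies TYPE('a) TYPE(linf2) \<longleftrightarrow>
         lattice_schaeffer TYPE('a) = 1"
  unfolding lattice_schaeffer_eq_1_iff[OF nonzero]
proof
  assume "contains_lattice_almost_isometric_copies TYPE('a) TYPE(linf2)"
  then show "\<forall>\<delta>>0. \<exists>x\<in>unit_sphere_pos. \<exists>y\<in>unit_sphere_pos. norm (x + y :: 'a) \<le> 1 + \<delta>"
    unfolding contains_lattice_almost_isometric_copies_def
    by (meson copy_imp_small_norm_add order_trans)
next
  assume small: "\<forall>\<delta>>0. \<exists>x\<in>unit_sphere_pos. \<exists>y\<in>unit_sphere_pos. norm (x + y :: 'a) \<le> 1 + \<delta>"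
  show "contains_lattice_almost_isometric_copies TYPE('a) TYPE(linf2)"
    unfolding contains_lattice_almost_isometric_copies_def
  proof (intro allI impI)
    fix \<epsilon> :: real assume "0 < \<epsilon>"
    \<comment> \<open>The solution of \<open>(1 + \<delta>) / (1 - \<delta>) = 1 + \<epsilon>\<close>.\<close>
    define \<delta> where "\<delta> = \<epsilon> / (2 + \<epsilon>)"
    have "0 < \<delta>" "\<delta> < 1" and eq: "(1 + \<delta>) / (1 - \<delta>) = 1 + \<epsilon>"
      using \<open>0 < \<epsilon>\<close> by (simp_all add: \<delta>_def field_simps)
    then show "\<exists>Z. \<exists>T :: linf2 \<Rightarrow> 'a.
        banach_lattice_iso_onto T Z \<and> onorm T * onorm_on Z (inv T) \<le> 1 + \<epsilon>"
      using small small_norm_add_imp_copy[where \<delta> = \<delta> and 'a = 'a] unfolding eq by blast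
  qed
qed

end
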